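(* Let $R$ be a commutative ring with identity, let $S$ be an anti-Archimedean multiplicative subset of $R$, and let $T$ be a (commutative) ring extension of $R$. Suppose that $T$ is $S$-finite as an $R$-module. Then the following statements are equivalent: (1) $R$ is a uniformly $S$-Noetherian ring. (2) $T$ is a uniformly $S$-Noetherian ring. (3) There is $s\in S$ such that $\mathfrak p T$ is an $s$-finite $T$-ideal (i.e. $s$-finite as a $T$-module) for every prime ideal $\mathfrak p$ of $R$. (4) $T$ is a uniformly $S$-Noetherian $R$-module.
   Context: All rings are commutative with identity and all modules are unitary; a ring extension $T$ of $R$ contains $R$ as a subring with the same identity. A multiplicative subset $S$ of $R$ is a subset with $1\in S$ and $s_1s_2\in S$ for all $s_1,s_2\in S$; since $R\subseteq T$, $S$ is also a multiplicative subset of $T$. $S$ is called anti-Archimedean if $\left(\bigcap_{n\geq 1}s^nR\right)\cap S\neq\emptyset$ for every $s\in S$. For a ring $A$ with multiplicative subset $S$ and $s\in S$, an $A$-module $N$ is $s$-finite if there is a finitely generated $A$-submodule $F$ of $N$ with $sN\subseteq F\subseteq N$; $N$ is $S$-finite if it is $s$-finite for some $s\in S$. An $A$-module $M$ is uniformly $S$-Noetherian if there exists a single element $s\in S$ such that every $A$-submodule of $M$ is $s$-finite. The ring $A$ is a uniformly $S$-Noetherian ring if $A$ is uniformly $S$-Noetherian as an $A$-module. *)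

theory Defs
  imports "HOL-Algebra.Module" "HOL-Algebra.Ideal" "HOL-Algebra.Subrings"
begin

text \<open>A ring extension $R \subseteq T$ is a commutative ring \<open>T\<close> together with a subring
  \<open>R :: 'a set\<close> of \<open>T\<close>; the ring $R$ itself is then \<open>T\<lparr>carrier := R\<rparr>\<close>. The scalar
  multiplication of \<open>regular_module T\<close> is defined on all of \<open>T\<close>, so the same record serves as
  \<open>T\<close> viewed as a \<open>T\<close>-module and as \<open>T\<close> viewed as an $R$-module: the ring of scalars
  is a separate argument of the notions below.\<close>

definition regular_module :: "('a, 'm) ring_scheme \<Rightarrow> ('a, 'a) module" where
  "regular_module T =
    \<lparr>carrier = carrier T, mult = mult T, one = one T, zero = zero T, add = add T,
     smult = mult T\<rparr>"

lemma regular_module_subring: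
  assumes "cring T" and "subring R T"
  shows "module (T\<lparr>carrier := R\<rparr>) (regular_module T)"
proof -
  interpret T: cring T by (rule assms(1))
  note sub = subringE[OF assms(2)]
  have "cring (T\<lparr>carrier := R\<rparr>)"
    using T.subcring_iff[of R] T.subcringI'[OF assms(2)] sub(1) by blast
  moreover have "abelian_group (regular_module T)"
    by (rule abelian_groupI)
      (auto simp: regular_module_def T.a_ac intro: T.l_neg)
  ultimately show ?thesis
    using sub(1)
    by (intro moduleI)
      (auto simp: regular_module_def T.l_distr T.r_distr T.m_assoc subset_iff)
qed

definition submodule_span ::
    "('a, 'm) ring_scheme \<Rightarrow> ('a, 'b, 'n) module_scheme \<Rightarrow> 'b set \<Rightarrow> 'b set" where
  "submodule_span A M X = \<Inter>{H. submodule H A M \<and> X \<subseteq> H}"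

definition finitely_generated_module ::
    "('a, 'm) ring_scheme \<Rightarrow> ('a, 'b, 'n) module_scheme \<Rightarrow> bool" where
  "finitely_generated_module A M \<longleftrightarrow>
    (\<exists>X. finite X \<and> X \<subseteq> carrier M \<and> carrier M = submodule_span A M X)"

definition s_finite ::
    "('a, 'm) ring_scheme \<Rightarrow> 'a \<Rightarrow> ('a, 'b, 'n) module_scheme \<Rightarrow> bool" where
  "s_finite A s N \<longleftrightarrow>
    (\<exists>F. submodule F A N \<and> finitely_generated_module A (N\<lparr>carrier := F\<rparr>) \<and>
         (\<lambda>x. s \<odot>\<^bsub>N\<^esub> x) ` carrier N \<subseteq> F)"

definition S_finite ::
    "('a, 'm) ring_scheme \<Rightarrow> 'a set \<Rightarrow> ('a, 'b, 'n) module_scheme \<Rightarrow> bool" where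
  "S_finite A S N \<longleftrightarrow> (\<exists>s\<in>S. s_finite A s N)"

definition uniformly_S_Noetherian_module ::
    "('a, 'm) ring_scheme \<Rightarrow> 'a set \<Rightarrow> ('a, 'b, 'n) module_scheme \<Rightarrow> bool" where
  "uniformly_S_Noetherian_module A S M \<longleftrightarrow>
    (\<exists>s\<in>S. \<forall>H. submodule H A M \<longrightarrow> s_finite A s (M\<lparr>carrier := H\<rparr>))"

definition uniformly_S_Noetherian_ring :: "('a, 'm) ring_scheme \<Rightarrow> 'a set \<Rightarrow> bool" where
  "uniformly_S_Noetherian_ring A S \<longleftrightarrow>
    uniformly_S_Noetherian_module A S (regular_module A)"

text \<open>A multiplicative subset of a ring is a submonoid of its multiplicative monoid; \<open>0\<close> may
  belong to it.\<close>

definition anti_Archimedean :: "('a, 'm) ring_scheme \<Rightarrow> 'a set \<Rightarrow> bool" where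
  "anti_Archimedean R S \<longleftrightarrow>
    (\<forall>s\<in>S. (\<Inter>n\<in>{1::nat..}. PIdl\<^bsub>R\<^esub> (s [^]\<^bsub>R\<^esub> n)) \<inter> S \<noteq> {})"

end

theory Submission
  imports Defs
begin

text \<open>The implication that carries the equivalence leads from the extended primes to \<open>T\<close> as an
  \<open>R\<close>-module; all others are changes of scalars. A submodule of the \<open>R\<close>-module \<open>R\<close> or of the
  \<open>T\<close>-module \<open>T\<close> is also an \<open>R\<close>-submodule of \<open>T\<close>, so both rings inherit uniform
  \<open>S\<close>-Noetherianity from the \<open>R\<close>-module \<open>T\<close>; and if \<open>R\<close> or \<open>T\<close> has the property, then
  almost-generators of \<open>\<pp>\<close> or of \<open>\<pp> T\<close> show that \<open>\<pp> T\<close> is \<open>s\<close>-finite, with the same \<open>s\<close>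
  for all \<open>\<pp>\<close>.

  For the main implication, a tower argument (\<open>s_finite_restrict_scalars\<close>) makes every
  \<open>\<pp> T\<close> finite over \<open>R\<close> up to a single element of \<open>S\<close>. What remains is a theorem on a
  module \<open>M\<close> over \<open>R\<close>, in the spirit of Cohen's theorem that a ring with finitely generated
  primes is Noetherian: if \<open>M\<close> and all \<open>P M\<close>, for \<open>P\<close> prime, are \<open>S\<close>-finite, then so is
  every submodule (\<open>S_finite_of_prime_multiples\<close>). A submodule \<open>N\<close> maximal among those that
  are not \<open>S\<close>-finite would have a prime conductor \<open>P = (N : M)\<close>, and this \<open>P\<close> would already
  be the conductor \<open>(N : f)\<close> of one element \<open>f\<close>. Then \<open>N \<inter> R f \<subseteq> P M \<subseteq> N\<close>, and \<open>N\<close> is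
  \<open>S\<close>-finite because \<open>N + R f\<close> and \<open>P M\<close> are. Both steps rest on one exactness argument,
  \<open>s_finite_split\<close>.

  Maximality supplies the elements of \<open>S\<close> with no control over them, so the argument does not
  by itself give one multiplier for all submodules. Uniformity comes from applying it to the
  powers of a single \<open>s\<close> instead of \<open>S\<close>: every submodule is then \<open>s\<^sup>n\<close>-finite for some \<open>n\<close>,
  and the anti-Archimedean condition provides an element of \<open>S\<close> divisible by all \<open>s\<^sup>n\<close>.\<close>

section \<open>Submodules, spans and s-finiteness inside a fixed module\<close>

context module
begin

lemma submodule_iff:
  "submodule H R M \<longleftrightarrow> H \<subseteq> carrier M \<and> \<zero>\<^bsub>M\<^esub> \<in> H \<and>
    (\<forall>x\<in>H. \<forall>y\<in>H. x \<oplus>\<^bsub>M\<^esub> y \<in> H) \<and> (\<forall>a\<in>carrier R. \<forall>x\<in>H. a \<odot>\<^bsub>M\<^esub> x \<in> H)"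
    (is "_ \<longleftrightarrow> ?closed")
proof
  assume H: "submodule H R M"
  have "\<zero>\<^bsub>M\<^esub> \<in> H"
    using subgroup.one_closed[OF submodule.axioms(1)[OF H]] by simp
  then show ?closed
    using submoduleE[OF H] by blast
next
  assume c: ?closed
  have "\<ominus>\<^bsub>M\<^esub> x \<in> H" if "x \<in> H" for x
  proof -
    have x: "x \<in> carrier M" using c that by blast
    have "(\<ominus> \<one>) \<odot>\<^bsub>M\<^esub> x \<in> H" using c that by blast
    then show ?thesis using x by (simp add: smult_l_minus)
  qed
  with c show "submodule H R M"
    by (intro submoduleI) auto
qed

lemma submodule_subset: "submodule H R M \<Longrightarrow> H \<subseteq> carrier M"
  and submodule_zero: "submodule H R M \<Longrightarrow> \<zero>\<^bsub>M\<^esub> \<in> H"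
  and submodule_add: "submodule H R M \<Longrightarrow> x \<in> H \<Longrightarrow> y \<in> H \<Longrightarrow> x \<oplus>\<^bsub>M\<^esub> y \<in> H"
  and submodule_smult: "submodule H R M \<Longrightarrow> a \<in> carrier R \<Longrightarrow> x \<in> H \<Longrightarrow> a \<odot>\<^bsub>M\<^esub> x \<in> H"
  by (auto simp: submodule_iff)

lemma submodule_restrict_iff:
  assumes "submodule N R M"
  shows "submodule F R (M\<lparr>carrier := N\<rparr>) \<longleftrightarrow> submodule F R M \<and> F \<subseteq> N"
proof -
  interpret N: module R "M\<lparr>carrier := N\<rparr>"
    by (rule submodule.submodule_is_module[OF assms module_axioms])
  show ?thesis
    using submodule_subset[OF assms] by (auto simp: N.submodule_iff submodule_iff)
qed

lemma span_submodule:
  assumes "X \<subseteq> carrier M"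
  shows "submodule (submodule_span R M X) R M"
proof -
  have "submodule_span R M X \<subseteq> carrier M"
    unfolding submodule_span_def using assms carrier_is_submodule by blast
  then show ?thesis
    unfolding submodule_iff unfolding submodule_span_def
    by (auto intro: submodule_zero submodule_add submodule_smult)
qed

lemma span_superset: "X \<subseteq> submodule_span R M X"
  unfolding submodule_span_def by blast

lemma span_least: "submodule H R M \<Longrightarrow> X \<subseteq> H \<Longrightarrow> submodule_span R M X \<subseteq> H"
  unfolding submodule_span_def by blast

lemma span_mono: "X \<subseteq> Y \<Longrightarrow> submodule_span R M X \<subseteq> submodule_span R M Y"
  unfolding submodule_span_def by blast

lemma span_restrict:
  assumes N: "submodule N R M" and X: "X \<subseteq> N"
  shows "submodule_span R (M\<lparr>carrier := N\<rparr>) X = submodule_span R M X"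
proof
  have "submodule (submodule_span R M X) R (M\<lparr>carrier := N\<rparr>)"
    using span_submodule span_least[OF N X] X submodule_subset[OF N]
    by (simp add: submodule_restrict_iff[OF N])
  then show "submodule_span R (M\<lparr>carrier := N\<rparr>) X \<subseteq> submodule_span R M X"
    unfolding submodule_span_def[of R "M\<lparr>carrier := N\<rparr>"] using span_superset by blast
  show "submodule_span R M X \<subseteq> submodule_span R (M\<lparr>carrier := N\<rparr>) X"
    unfolding submodule_span_def submodule_restrict_iff[OF N] by blast
qed

text \<open>All arguments below use \<open>s\<close>-finiteness in this form, in which the submodule \<open>F\<close> and
  the module structures on \<open>F\<close> and \<open>N\<close> are replaced by a span taken in the ambient
  module \<open>M\<close>.\<close>

lemma s_finite_iff:
  assumes N: "submodule N R M"
  shows "s_finite R s (M\<lparr>carrier := N\<rparr>) \<longleftrightarrow>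
    (\<exists>X. finite X \<and> X \<subseteq> N \<and> (\<forall>x\<in>N. s \<odot>\<^bsub>M\<^esub> x \<in> submodule_span R M X))"
    (is "_ \<longleftrightarrow> ?R")
proof
  assume "s_finite R s (M\<lparr>carrier := N\<rparr>)"
  then obtain F X where F: "submodule F R M" "F \<subseteq> N" and X: "finite X" "X \<subseteq> F"
    and FX: "F = submodule_span R (M\<lparr>carrier := F\<rparr>) X"
    and s: "(\<lambda>x. s \<odot>\<^bsub>M\<^esub> x) ` N \<subseteq> F"
    unfolding s_finite_def finitely_generated_module_def submodule_restrict_iff[OF N]
    by auto
  show ?R
    using X F s FX span_restrict[OF F(1) X(2)] by blast
next
  assume ?R
  then obtain X where X: "finite X" "X \<subseteq> N"
    and s: "\<forall>x\<in>N. s \<odot>\<^bsub>M\<^esub> x \<in> submodule_span R M X" by blast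
  let ?F = "submodule_span R M X"
  have F: "submodule ?F R M"
    using X(2) submodule_subset[OF N] by (intro span_submodule) blast
  have "?F = submodule_span R (M\<lparr>carrier := ?F\<rparr>) X"
    using span_restrict[OF F span_superset] by simp
  then have "finitely_generated_module R (M\<lparr>carrier := ?F\<rparr>)"
    unfolding finitely_generated_module_def using X(1) span_superset by auto
  then show "s_finite R s (M\<lparr>carrier := N\<rparr>)"
    unfolding s_finite_def submodule_restrict_iff[OF N]
    using F s span_least[OF N X(2)] by auto
qed

lemma s_finite_multiple:
  assumes N: "submodule N R M" and c: "c \<in> carrier R" and s: "s \<in> carrier R"
    and fin: "s_finite R s (M\<lparr>carrier := N\<rparr>)"
  shows "s_finite R (c \<otimes> s) (M\<lparr>carrier := N\<rparr>)"
proof -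
  note sub = submodule_subset[OF N]
  obtain X where X: "finite X" "X \<subseteq> N"
    and sX: "\<forall>x\<in>N. s \<odot>\<^bsub>M\<^esub> x \<in> submodule_span R M X"
    using fin unfolding s_finite_iff[OF N] by blast
  have "submodule (submodule_span R M X) R M"
    using X sub by (intro span_submodule) blast
  then have "(c \<otimes> s) \<odot>\<^bsub>M\<^esub> x \<in> submodule_span R M X" if "x \<in> N" for x
    using that sX sub c s by (auto simp: smult_assoc1 subset_iff intro: submodule_smult)
  with X show ?thesis unfolding s_finite_iff[OF N] by blast
qed

lemma submodule_set_add:
  assumes A: "submodule A R M" and B: "submodule B R M"
  shows "submodule (A <+>\<^bsub>M\<^esub> B) R M"
proof -
  note sA = submodule_subset[OF A] and sB = submodule_subset[OF B]
  have mem: "u \<oplus>\<^bsub>M\<^esub> v \<in> A <+>\<^bsub>M\<^esub> B" if "u \<in> A" "v \<in> B" for u v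
    using that by (auto simp: set_add_def')
  have elim: "\<exists>u\<in>A. \<exists>v\<in>B. x = u \<oplus>\<^bsub>M\<^esub> v" if "x \<in> A <+>\<^bsub>M\<^esub> B" for x
    using that by (auto simp: set_add_def')
  show ?thesis
    unfolding submodule_iff
  proof (intro conjI ballI)
    show "A <+>\<^bsub>M\<^esub> B \<subseteq> carrier M"
      using sA sB by (auto simp: set_add_def')
    show "\<zero>\<^bsub>M\<^esub> \<in> A <+>\<^bsub>M\<^esub> B"
      using mem[OF submodule_zero[OF A] submodule_zero[OF B]] by simp
  next
    fix x y assume "x \<in> A <+>\<^bsub>M\<^esub> B" "y \<in> A <+>\<^bsub>M\<^esub> B"
    then obtain u v u' v' where uv: "u \<in> A" "v \<in> B" "u' \<in> A" "v' \<in> B"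
      and xy: "x = u \<oplus>\<^bsub>M\<^esub> v" "y = u' \<oplus>\<^bsub>M\<^esub> v'"
      using elim by meson
    have c: "u \<in> carrier M" "v \<in> carrier M" "u' \<in> carrier M" "v' \<in> carrier M"
      using uv sA sB by auto
    have "x \<oplus>\<^bsub>M\<^esub> y = (u \<oplus>\<^bsub>M\<^esub> u') \<oplus>\<^bsub>M\<^esub> (v \<oplus>\<^bsub>M\<^esub> v')"
      unfolding xy using c by (simp add: M.a_ac)
    then show "x \<oplus>\<^bsub>M\<^esub> y \<in> A <+>\<^bsub>M\<^esub> B"
      using uv mem submodule_add[OF A] submodule_add[OF B] by simp
  next
    fix a x assume a: "a \<in> carrier R" and "x \<in> A <+>\<^bsub>M\<^esub> B"
    then obtain u v where uv: "u \<in> A" "v \<in> B" and x: "x = u \<oplus>\<^bsub>M\<^esub> v"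
      using elim by meson
    have "a \<odot>\<^bsub>M\<^esub> x = a \<odot>\<^bsub>M\<^esub> u \<oplus>\<^bsub>M\<^esub> a \<odot>\<^bsub>M\<^esub> v"
      unfolding x using uv sA sB a by (intro smult_r_distr) auto
    then show "a \<odot>\<^bsub>M\<^esub> x \<in> A <+>\<^bsub>M\<^esub> B"
      using uv a mem submodule_smult[OF A] submodule_smult[OF B] by simp
  qed
qed

lemma set_add_upper:
  assumes A: "submodule A R M" and B: "submodule B R M"
  shows "A \<subseteq> A <+>\<^bsub>M\<^esub> B" and "B \<subseteq> A <+>\<^bsub>M\<^esub> B"
proof -
  have "x \<in> A <+>\<^bsub>M\<^esub> B" if "x \<in> A" for x
    unfolding set_add_def'
    using that submodule_subset[OF A] submodule_zero[OF B] by (force intro: bexI[of _ "\<zero>\<^bsub>M\<^esub>"])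
  then show "A \<subseteq> A <+>\<^bsub>M\<^esub> B" by blast
  have "x \<in> A <+>\<^bsub>M\<^esub> B" if "x \<in> B" for x
    unfolding set_add_def'
    using that submodule_subset[OF B] submodule_zero[OF A]
    by (force intro: bexI[of _ "\<zero>\<^bsub>M\<^esub>"] bexI[of _ x])
  then show "B \<subseteq> A <+>\<^bsub>M\<^esub> B" by blast
qed

lemma submodule_smult_image:
  assumes a: "a \<in> carrier R" and N: "submodule N R M"
  shows "submodule ((\<lambda>x. a \<odot>\<^bsub>M\<^esub> x) ` N) R M"
proof -
  note sub = submodule_subset[OF N]
  show ?thesis
    unfolding submodule_iff
  proof (intro conjI ballI)
    show "(\<lambda>x. a \<odot>\<^bsub>M\<^esub> x) ` N \<subseteq> carrier M" using a sub by auto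
    show "\<zero>\<^bsub>M\<^esub> \<in> (\<lambda>x. a \<odot>\<^bsub>M\<^esub> x) ` N"
      using submodule_zero[OF N] a by (intro image_eqI[of _ _ "\<zero>\<^bsub>M\<^esub>"]) auto
  next
    fix x y assume "x \<in> (\<lambda>x. a \<odot>\<^bsub>M\<^esub> x) ` N" "y \<in> (\<lambda>x. a \<odot>\<^bsub>M\<^esub> x) ` N"
    then obtain u v where uv: "u \<in> N" "v \<in> N" "x = a \<odot>\<^bsub>M\<^esub> u" "y = a \<odot>\<^bsub>M\<^esub> v" by blast
    then have "x \<oplus>\<^bsub>M\<^esub> y = a \<odot>\<^bsub>M\<^esub> (u \<oplus>\<^bsub>M\<^esub> v)"
      using a sub by (simp add: smult_r_distr subset_iff)
    then show "x \<oplus>\<^bsub>M\<^esub> y \<in> (\<lambda>x. a \<odot>\<^bsub>M\<^esub> x) ` N"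
      using uv submodule_add[OF N] by blast
  next
    fix b x assume b: "b \<in> carrier R" and "x \<in> (\<lambda>x. a \<odot>\<^bsub>M\<^esub> x) ` N"
    then obtain u where u: "u \<in> N" "x = a \<odot>\<^bsub>M\<^esub> u" by blast
    then have "b \<odot>\<^bsub>M\<^esub> x = a \<odot>\<^bsub>M\<^esub> (b \<odot>\<^bsub>M\<^esub> u)"
      using a b sub by (simp add: smult_assoc1[symmetric] subset_iff R.m_comm)
    then show "b \<odot>\<^bsub>M\<^esub> x \<in> (\<lambda>x. a \<odot>\<^bsub>M\<^esub> x) ` N"
      using u b submodule_smult[OF N] by blast
  qed
qed

lemma submodule_smult_vimage:
  assumes a: "a \<in> carrier R" and N: "submodule N R M"
  shows "submodule {x \<in> carrier M. a \<odot>\<^bsub>M\<^esub> x \<in> N} R M"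
proof -
  have "a \<odot>\<^bsub>M\<^esub> (b \<odot>\<^bsub>M\<^esub> x) = b \<odot>\<^bsub>M\<^esub> (a \<odot>\<^bsub>M\<^esub> x)" if "b \<in> carrier R" "x \<in> carrier M" for b x
    using that a by (simp add: smult_assoc1[symmetric] R.m_comm)
  then show ?thesis
    using a N unfolding submodule_iff by (auto simp: smult_r_distr)
qed

lemma submodule_cyclic:
  assumes f: "f \<in> carrier M"
  shows "submodule ((\<lambda>r. r \<odot>\<^bsub>M\<^esub> f) ` carrier R) R M"
  unfolding submodule_iff
proof (intro conjI ballI)
  show "(\<lambda>r. r \<odot>\<^bsub>M\<^esub> f) ` carrier R \<subseteq> carrier M" using f by auto
  show "\<zero>\<^bsub>M\<^esub> \<in> (\<lambda>r. r \<odot>\<^bsub>M\<^esub> f) ` carrier R"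
    using f by (intro image_eqI[of _ _ "\<zero>"]) auto
next
  fix x y assume "x \<in> (\<lambda>r. r \<odot>\<^bsub>M\<^esub> f) ` carrier R" "y \<in> (\<lambda>r. r \<odot>\<^bsub>M\<^esub> f) ` carrier R"
  then obtain p q where "p \<in> carrier R" "q \<in> carrier R" "x = p \<odot>\<^bsub>M\<^esub> f" "y = q \<odot>\<^bsub>M\<^esub> f" by blast
  then show "x \<oplus>\<^bsub>M\<^esub> y \<in> (\<lambda>r. r \<odot>\<^bsub>M\<^esub> f) ` carrier R"
    using f by (intro image_eqI[of _ _ "p \<oplus> q"]) (auto simp: smult_l_distr)
next
  fix b x assume b: "b \<in> carrier R" and "x \<in> (\<lambda>r. r \<odot>\<^bsub>M\<^esub> f) ` carrier R"
  then obtain p where "p \<in> carrier R" "x = p \<odot>\<^bsub>M\<^esub> f" by blast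
  then show "b \<odot>\<^bsub>M\<^esub> x \<in> (\<lambda>r. r \<odot>\<^bsub>M\<^esub> f) ` carrier R"
    using f b by (intro image_eqI[of _ _ "b \<otimes> p"]) (auto simp: smult_assoc1)
qed

lemma s_finite_smult_image:
  assumes a: "a \<in> carrier R" and s: "s \<in> carrier R" and N: "submodule N R M"
    and fin: "s_finite R s (M\<lparr>carrier := N\<rparr>)"
  shows "s_finite R s (M\<lparr>carrier := (\<lambda>x. a \<odot>\<^bsub>M\<^esub> x) ` N\<rparr>)"
proof -
  note sub = submodule_subset[OF N]
  obtain X where X: "finite X" "X \<subseteq> N"
    and sX: "\<forall>x\<in>N. s \<odot>\<^bsub>M\<^esub> x \<in> submodule_span R M X"
    using fin unfolding s_finite_iff[OF N] by blast
  let ?aX = "(\<lambda>x. a \<odot>\<^bsub>M\<^esub> x) ` X"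
  have aX: "submodule (submodule_span R M ?aX) R M"
    using X sub a by (intro span_submodule) auto
  have "submodule_span R M X \<subseteq> {x \<in> carrier M. a \<odot>\<^bsub>M\<^esub> x \<in> submodule_span R M ?aX}"
    using X sub span_superset[of ?aX]
    by (intro span_least submodule_smult_vimage[OF a aX]) auto
  then have "s \<odot>\<^bsub>M\<^esub> (a \<odot>\<^bsub>M\<^esub> x) \<in> submodule_span R M ?aX" if "x \<in> N" for x
  proof -
    have "s \<odot>\<^bsub>M\<^esub> (a \<odot>\<^bsub>M\<^esub> x) = a \<odot>\<^bsub>M\<^esub> (s \<odot>\<^bsub>M\<^esub> x)"
      using that sub a s by (simp add: smult_assoc1[symmetric] R.m_comm subset_iff)
    then show ?thesis
      using that sX \<open>submodule_span R M X \<subseteq> _\<close> by auto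
  qed
  with X show ?thesis
    unfolding s_finite_iff[OF submodule_smult_image[OF a N]]
    by (intro exI[of _ ?aX]) auto
qed

text \<open>Finiteness passes from \<open>(N + L) / L\<close> and \<open>N \<inter> L\<close> to \<open>N\<close>, because the former is
  isomorphic to \<open>N / (N \<inter> L)\<close>. Splitting generators of \<open>N + L\<close> into their two components
  writes \<open>s x\<close>, for \<open>x \<in> N\<close>, as a combination of finitely many elements of \<open>N\<close> plus an error
  in \<open>N \<inter> L\<close>. The error only has to be controlled by some \<open>W\<close> between \<open>N \<inter> L\<close> and \<open>N\<close>;
  this slack is needed when \<open>W = P M\<close> for an ideal \<open>P\<close>.\<close>

lemma s_finite_split:
  assumes N: "submodule N R M" and L: "submodule L R M" and W: "submodule W R M"
    and NL: "N \<inter> L \<subseteq> W" and WN: "W \<subseteq> N"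
    and s: "s \<in> carrier R" and t: "t \<in> carrier R"
    and sum_fin: "s_finite R s (M\<lparr>carrier := N <+>\<^bsub>M\<^esub> L\<rparr>)"
    and W_fin: "s_finite R t (M\<lparr>carrier := W\<rparr>)"
  shows "s_finite R (t \<otimes> s) (M\<lparr>carrier := N\<rparr>)"
proof -
  note subN = submodule_subset[OF N] and subL = submodule_subset[OF L]
  obtain Y where Y: "finite Y" "Y \<subseteq> N <+>\<^bsub>M\<^esub> L"
    and sY: "\<forall>x\<in>N <+>\<^bsub>M\<^esub> L. s \<odot>\<^bsub>M\<^esub> x \<in> submodule_span R M Y"
    using sum_fin unfolding s_finite_iff[OF submodule_set_add[OF N L]] by blast
  obtain Q where Q: "finite Q" "Q \<subseteq> W"
    and tQ: "\<forall>x\<in>W. t \<odot>\<^bsub>M\<^esub> x \<in> submodule_span R M Q"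
    using W_fin unfolding s_finite_iff[OF W] by blast
  have "\<forall>y\<in>Y. \<exists>n. n \<in> N \<and> (\<exists>l\<in>L. y = n \<oplus>\<^bsub>M\<^esub> l)"
    using Y(2) by (fastforce simp: set_add_def')
  then obtain n where n: "\<And>y. y \<in> Y \<Longrightarrow> n y \<in> N \<and> (\<exists>l\<in>L. y = n y \<oplus>\<^bsub>M\<^esub> l)"
    by metis
  define Z where "Z = n ` Y"
  have Z: "finite Z" "Z \<subseteq> N" using Y(1) n by (auto simp: Z_def)
  have spZ: "submodule (submodule_span R M Z) R M"
    using Z subN by (intro span_submodule) blast
  have YZ: "submodule_span R M Y \<subseteq> submodule_span R M Z <+>\<^bsub>M\<^esub> L"
  proof (rule span_least[OF submodule_set_add[OF spZ L]], rule subsetI)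
    fix y assume y: "y \<in> Y"
    then obtain l where "l \<in> L" "y = n y \<oplus>\<^bsub>M\<^esub> l" using n by blast
    moreover have "n y \<in> submodule_span R M Z" using y span_superset[of Z] by (auto simp: Z_def)
    ultimately show "y \<in> submodule_span R M Z <+>\<^bsub>M\<^esub> L" by (auto simp: set_add_def')
  qed
  let ?G = "submodule_span R M (Z \<union> Q)"
  have G: "submodule ?G R M"
    using Z Q WN subN by (intro span_submodule) blast
  have "(t \<otimes> s) \<odot>\<^bsub>M\<^esub> x \<in> ?G" if x: "x \<in> N" for x
  proof -
    have xM: "x \<in> carrier M" using x subN by blast
    have "s \<odot>\<^bsub>M\<^esub> x \<in> submodule_span R M Z <+>\<^bsub>M\<^esub> L"
      using x sY YZ set_add_upper(1)[OF N L] by blast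
    then obtain z l where z: "z \<in> submodule_span R M Z" and l: "l \<in> L"
      and sx: "s \<odot>\<^bsub>M\<^esub> x = z \<oplus>\<^bsub>M\<^esub> l"
      by (auto simp: set_add_def')
    have zN: "z \<in> N" using z span_least[OF N Z(2)] by blast
    have c: "z \<in> carrier M" "l \<in> carrier M" using zN l subN subL by auto
    have "\<ominus>\<^bsub>M\<^esub> z \<in> N" using submoduleE(3)[OF N zN] .
    moreover have "s \<odot>\<^bsub>M\<^esub> x \<in> N" using submodule_smult[OF N s x] .
    ultimately have "\<ominus>\<^bsub>M\<^esub> z \<oplus>\<^bsub>M\<^esub> (z \<oplus>\<^bsub>M\<^esub> l) \<in> N"
      unfolding sx by (rule submodule_add[OF N])
    then have "l \<in> N" using c by (simp add: M.r_neg1)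
    then have tl: "t \<odot>\<^bsub>M\<^esub> l \<in> ?G"
      using l NL tQ span_mono[of Q "Z \<union> Q"] by blast
    have tz: "t \<odot>\<^bsub>M\<^esub> z \<in> ?G"
      using z span_mono[of Z "Z \<union> Q"] submodule_smult[OF G t] by blast
    have "(t \<otimes> s) \<odot>\<^bsub>M\<^esub> x = t \<odot>\<^bsub>M\<^esub> z \<oplus>\<^bsub>M\<^esub> t \<odot>\<^bsub>M\<^esub> l"
      using t s xM c by (simp add: smult_assoc1 sx smult_r_distr)
    then show ?thesis using submodule_add[OF G tz tl] by simp
  qed
  moreover have "finite (Z \<union> Q)" "Z \<union> Q \<subseteq> N" using Z Q WN by auto
  ultimately show ?thesis unfolding s_finite_iff[OF N] by blast
qed

section \<open>Cohen's theorem for a multiplicative set\<close>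

lemma maximal_non_S_finite_exists:
  assumes N: "submodule N R M" and N_inf: "\<not> S_finite R S (M\<lparr>carrier := N\<rparr>)"
  obtains K where "submodule K R M" "\<not> S_finite R S (M\<lparr>carrier := K\<rparr>)"
    "\<And>H. submodule H R M \<Longrightarrow> K \<subset> H \<Longrightarrow> S_finite R S (M\<lparr>carrier := H\<rparr>)"
proof -
  let ?A = "{H. submodule H R M \<and> \<not> S_finite R S (M\<lparr>carrier := H\<rparr>)}"
  have "\<exists>K\<in>?A. \<forall>H\<in>?A. K \<subseteq> H \<longrightarrow> H = K"
  proof (rule subset_Zorn_nonempty)
    show "?A \<noteq> {}" using N N_inf by blast
  next
    fix C assume C0: "C \<noteq> {}" and C: "subset.chain ?A C"
    have sub: "submodule H R M" if "H \<in> C" for H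
      using that C by (auto simp: subset.chain_def)
    have dir: "H \<subseteq> K \<or> K \<subseteq> H" if "H \<in> C" "K \<in> C" for H K
      using that C by (auto simp: subset.chain_def)
    have U: "submodule (\<Union>C) R M"
      unfolding submodule_iff
    proof (intro conjI ballI)
      show "\<Union>C \<subseteq> carrier M" using sub submodule_subset by blast
      show "\<zero>\<^bsub>M\<^esub> \<in> \<Union>C" using C0 sub submodule_zero by blast
    next
      fix x y assume "x \<in> \<Union>C" "y \<in> \<Union>C"
      then obtain H where "H \<in> C" "x \<in> H" "y \<in> H" using dir by blast
      then show "x \<oplus>\<^bsub>M\<^esub> y \<in> \<Union>C" using sub submodule_add by blast
    next
      fix a x assume "a \<in> carrier R" "x \<in> \<Union>C"
      then show "a \<odot>\<^bsub>M\<^esub> x \<in> \<Union>C" using sub submodule_smult by blast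
    qed
    moreover have "\<not> S_finite R S (M\<lparr>carrier := \<Union>C\<rparr>)"
    proof
      assume "S_finite R S (M\<lparr>carrier := \<Union>C\<rparr>)"
      then obtain s X where s: "s \<in> S" and X: "finite X" "X \<subseteq> \<Union>C"
        and sX: "\<forall>x\<in>\<Union>C. s \<odot>\<^bsub>M\<^esub> x \<in> submodule_span R M X"
        unfolding S_finite_def s_finite_iff[OF U] by blast
      have "subset.chain C C" using C by (auto simp: subset.chain_def)
      \<comment> \<open>a finite set of generators of the union already lies in one member of the chain\<close>
      then obtain H where H: "H \<in> C" "X \<subseteq> H"
        using finite_subset_Union_chain[OF X C0] by blast
      then have "s_finite R s (M\<lparr>carrier := H\<rparr>)"
        unfolding s_finite_iff[OF sub[OF H(1)]] using X(1) sX by blast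
      with s H(1) C show False by (auto simp: subset.chain_def S_finite_def)
    qed
    ultimately show "\<Union>C \<in> ?A" by blast
  qed
  then obtain K where "K \<in> ?A" and "\<forall>H\<in>?A. K \<subseteq> H \<longrightarrow> H = K" by blast
  then show ?thesis by (intro that[of K]) auto
qed

text \<open>If \<open>ab\<close> lies in the conductor \<open>P = (N : M)\<close> but \<open>a\<close> and \<open>b\<close> do not, then both
  \<open>N + a M\<close> and \<open>(N : a) \<supseteq> N + b M\<close> are strictly larger than \<open>N\<close>, hence \<open>S\<close>-finite. As
  \<open>N \<inter> a M = a (N : a)\<close> is then \<open>S\<close>-finite too, splitting along \<open>a M\<close> would make \<open>N\<close>
  \<open>S\<close>-finite.\<close>

lemma conductor_of_maximal_non_S_finite_prime:
  assumes S: "submonoid S R" and N: "submodule N R M"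
    and N_inf: "\<not> S_finite R S (M\<lparr>carrier := N\<rparr>)"
    and N_max: "\<And>H. submodule H R M \<Longrightarrow> N \<subset> H \<Longrightarrow> S_finite R S (M\<lparr>carrier := H\<rparr>)"
    and M_fin: "S_finite R S M"
  shows "primeideal {r \<in> carrier R. \<forall>m\<in>carrier M. r \<odot>\<^bsub>M\<^esub> m \<in> N} R"
    (is "primeideal ?P R")
proof (rule primeidealI)
  note sub = submodule_subset[OF N]
  note SR = submonoid.subset[OF S]
  show "ideal ?P R"
  proof (rule idealI)
    show "ring R" by (rule R.ring_axioms)
    show "subgroup ?P (add_monoid R)"
    proof (rule R.add.subgroupI)
      show "?P \<subseteq> carrier R" by blast
      show "?P \<noteq> {}" using submodule_zero[OF N] by (auto intro!: exI[of _ "\<zero>"])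
      show "\<ominus> a \<in> ?P" if "a \<in> ?P" for a
        using that submoduleE(3)[OF N] by (auto simp: smult_l_minus)
      show "a \<oplus> b \<in> ?P" if "a \<in> ?P" "b \<in> ?P" for a b
        using that submodule_add[OF N] by (auto simp: smult_l_distr)
    qed
  next
    fix a x assume a: "a \<in> ?P" and x: "x \<in> carrier R"
    show "x \<otimes> a \<in> ?P"
      using a x submodule_smult[OF N] by (auto simp: smult_assoc1)
    show "a \<otimes> x \<in> ?P" using a x by (auto simp: smult_assoc1)
  qed
  show "cring R" by (rule R.cring_axioms)
  show "carrier R \<noteq> ?P"
  proof
    assume "carrier R = ?P"
    then have "\<one> \<in> ?P" using R.one_closed by blast
    then have "N = carrier M" using sub by auto
    then show False using N_inf M_fin by simp
  qed
  fix a b assume a: "a \<in> carrier R" and b: "b \<in> carrier R" and ab: "a \<otimes> b \<in> ?P"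
  show "a \<in> ?P \<or> b \<in> ?P"
  proof (rule ccontr)
    assume "\<not> (a \<in> ?P \<or> b \<in> ?P)"
    then obtain m m' where m: "m \<in> carrier M" "a \<odot>\<^bsub>M\<^esub> m \<notin> N"
      and m': "m' \<in> carrier M" "b \<odot>\<^bsub>M\<^esub> m' \<notin> N"
      using a b by auto
    let ?L = "(\<lambda>x. a \<odot>\<^bsub>M\<^esub> x) ` carrier M"
    let ?C = "{x \<in> carrier M. a \<odot>\<^bsub>M\<^esub> x \<in> N}"
    let ?W = "(\<lambda>x. a \<odot>\<^bsub>M\<^esub> x) ` ?C"
    note L = submodule_smult_image[OF a carrier_is_submodule]
    note C = submodule_smult_vimage[OF a N]
    note W = submodule_smult_image[OF a C]
    have "N \<subset> N <+>\<^bsub>M\<^esub> ?L"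
      using set_add_upper[OF N L] m by blast
    then obtain s where s: "s \<in> S" "s_finite R s (M\<lparr>carrier := N <+>\<^bsub>M\<^esub> ?L\<rparr>)"
      using N_max[OF submodule_set_add[OF N L]] by (auto simp: S_finite_def)
    have "a \<odot>\<^bsub>M\<^esub> (b \<odot>\<^bsub>M\<^esub> m') \<in> N"
      using ab a b m' by (auto simp: smult_assoc1)
    then have "b \<odot>\<^bsub>M\<^esub> m' \<in> ?C" using b m' by auto
    moreover have "N \<subseteq> ?C" using sub submodule_smult[OF N a] by blast
    ultimately have "N \<subset> ?C" using m'(2) by blast
    then obtain t where t: "t \<in> S" "s_finite R t (M\<lparr>carrier := ?C\<rparr>)"
      using N_max[OF C] by (auto simp: S_finite_def)
    have "s_finite R t (M\<lparr>carrier := ?W\<rparr>)"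
      using t SR by (intro s_finite_smult_image[OF a _ C]) auto
    then have "s_finite R (t \<otimes> s) (M\<lparr>carrier := N\<rparr>)"
      using s t SR by (intro s_finite_split[OF N L W]) auto
    then show False
      using N_inf submonoid.m_closed[OF S t(1) s(1)] by (auto simp: S_finite_def)
  qed
qed

definition ideal_times_module where
  "ideal_times_module P =
    submodule_span R M {p \<odot>\<^bsub>M\<^esub> m | p m. p \<in> P \<and> m \<in> carrier M}"

lemma ideal_times_submodule:
  "P \<subseteq> carrier R \<Longrightarrow> submodule (ideal_times_module P) R M"
  unfolding ideal_times_module_def by (rule span_submodule) auto

lemma common_multiplier_outside_prime:
  assumes P: "primeideal P R" and N: "submodule N R M" and "finite X"
    and "\<forall>f\<in>X. \<exists>a\<in>carrier R - P. a \<odot>\<^bsub>M\<^esub> f \<in> N" and "X \<subseteq> carrier M"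
  shows "\<exists>a\<in>carrier R - P. \<forall>f\<in>X. a \<odot>\<^bsub>M\<^esub> f \<in> N"
  using assms(3-5)
proof (induction X rule: finite_induct)
  case empty
  interpret P: primeideal P R by (rule P)
  have "\<one> \<notin> P" using P.I_notcarr P.one_imp_carrier by blast
  then show ?case by auto
next
  case (insert f X)
  obtain a where a: "a \<in> carrier R - P" "\<forall>g\<in>X. a \<odot>\<^bsub>M\<^esub> g \<in> N"
    using insert.IH insert.prems by blast
  obtain b where b: "b \<in> carrier R - P" "b \<odot>\<^bsub>M\<^esub> f \<in> N"
    using insert.prems by blast
  have "b \<otimes> a \<in> carrier R - P"
    using a b primeideal.I_prime[OF P] by blast
  moreover have "(b \<otimes> a) \<odot>\<^bsub>M\<^esub> f \<in> N"
    using a b insert.prems submodule_smult[OF N, of a "b \<odot>\<^bsub>M\<^esub> f"]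
    by (simp add: smult_assoc1[symmetric] R.m_comm)
  moreover have "(b \<otimes> a) \<odot>\<^bsub>M\<^esub> g \<in> N" if "g \<in> X" for g
    using a b that insert.prems submodule_smult[OF N, of b "a \<odot>\<^bsub>M\<^esub> g"]
    by (auto simp: smult_assoc1)
  ultimately show ?case by blast
qed

text \<open>For a maximal non-\<open>S\<close>-finite \<open>N\<close> with conductor \<open>P = (N : M)\<close>, some \<open>f\<close> satisfies
  \<open>(N : f) = P\<close>: otherwise primality of \<open>P\<close> gives one \<open>a \<notin> P\<close> that carries all of finitely
  many almost-generators of \<open>M\<close> into \<open>N\<close>, so that \<open>a s \<in> P\<close> for some \<open>s \<in> S\<close>, while \<open>S\<close>
  misses \<open>P\<close>. For this \<open>f\<close> the intersection \<open>N \<inter> R f = P f\<close> lies inside \<open>P M \<subseteq> N\<close>, and the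
  \<open>S\<close>-finiteness of \<open>P M\<close> and of \<open>N + R f\<close> forces that of \<open>N\<close>.\<close>

theorem S_finite_of_prime_multiples:
  assumes S: "submonoid S R" and M_fin: "S_finite R S M"
    and primes: "\<And>P. primeideal P R \<Longrightarrow> S_finite R S (M\<lparr>carrier := ideal_times_module P\<rparr>)"
    and H: "submodule H R M"
  shows "S_finite R S (M\<lparr>carrier := H\<rparr>)"
proof (rule ccontr)
  assume "\<not> S_finite R S (M\<lparr>carrier := H\<rparr>)"
  then obtain N where N: "submodule N R M" and N_inf: "\<not> S_finite R S (M\<lparr>carrier := N\<rparr>)"
    and N_max: "\<And>H. submodule H R M \<Longrightarrow> N \<subset> H \<Longrightarrow> S_finite R S (M\<lparr>carrier := H\<rparr>)"
    using maximal_non_S_finite_exists[OF H] by blast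
  note SR = submonoid.subset[OF S]
  note sub = submodule_subset[OF N]
  define P where "P = {r \<in> carrier R. \<forall>m\<in>carrier M. r \<odot>\<^bsub>M\<^esub> m \<in> N}"
  have P: "primeideal P R"
    unfolding P_def
    by (rule conductor_of_maximal_non_S_finite_prime[OF S N N_inf N_max M_fin])
  have PR: "P \<subseteq> carrier R" by (auto simp: P_def)
  obtain s where s: "s \<in> S" and "s_finite R s (M\<lparr>carrier := carrier M\<rparr>)"
    using M_fin by (auto simp: S_finite_def)
  then obtain X where X: "finite X" "X \<subseteq> carrier M"
    and sX: "\<forall>x\<in>carrier M. s \<odot>\<^bsub>M\<^esub> x \<in> submodule_span R M X"
    unfolding s_finite_iff[OF carrier_is_submodule] by blast
  have sR: "s \<in> carrier R" using s SR by blast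
  have "s \<notin> P"
  proof
    \<comment> \<open>almost-generators of \<open>s M\<close> lie in \<open>N\<close>, and their span contains \<open>s\<^sup>2 M \<supseteq> s\<^sup>2 N\<close>\<close>
    assume "s \<in> P"
    have "s_finite R s (M\<lparr>carrier := (\<lambda>x. s \<odot>\<^bsub>M\<^esub> x) ` carrier M\<rparr>)"
      using \<open>s_finite R s (M\<lparr>carrier := carrier M\<rparr>)\<close>
      by (rule s_finite_smult_image[OF sR sR carrier_is_submodule])
    then obtain Y where Y: "finite Y" "Y \<subseteq> (\<lambda>x. s \<odot>\<^bsub>M\<^esub> x) ` carrier M"
      and sY: "\<forall>x\<in>carrier M. s \<odot>\<^bsub>M\<^esub> (s \<odot>\<^bsub>M\<^esub> x) \<in> submodule_span R M Y"
      unfolding s_finite_iff[OF submodule_smult_image[OF sR carrier_is_submodule]] by blast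
    have "Y \<subseteq> N" using Y(2) \<open>s \<in> P\<close> by (auto simp: P_def)
    moreover have "\<forall>x\<in>N. (s \<otimes> s) \<odot>\<^bsub>M\<^esub> x \<in> submodule_span R M Y"
      using sY sub sR by (auto simp: smult_assoc1 subset_iff)
    ultimately have "s_finite R (s \<otimes> s) (M\<lparr>carrier := N\<rparr>)"
      unfolding s_finite_iff[OF N] using Y(1) by blast
    then show False
      using N_inf submonoid.m_closed[OF S s s] by (auto simp: S_finite_def)
  qed
  have "\<exists>f\<in>X. \<forall>r\<in>carrier R. r \<odot>\<^bsub>M\<^esub> f \<in> N \<longrightarrow> r \<in> P"
  proof (rule ccontr)
    assume "\<not> ?thesis"
    then have "\<forall>f\<in>X. \<exists>a\<in>carrier R - P. a \<odot>\<^bsub>M\<^esub> f \<in> N" by blast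
    then obtain a where a: "a \<in> carrier R" "a \<notin> P" and aX: "\<forall>f\<in>X. a \<odot>\<^bsub>M\<^esub> f \<in> N"
      using common_multiplier_outside_prime[OF P N X(1) _ X(2)] by blast
    have "submodule_span R M X \<subseteq> {x \<in> carrier M. a \<odot>\<^bsub>M\<^esub> x \<in> N}"
      using X aX by (intro span_least submodule_smult_vimage[OF a(1) N]) auto
    then have "\<forall>m\<in>carrier M. (a \<otimes> s) \<odot>\<^bsub>M\<^esub> m \<in> N"
      using sX a(1) sR by (auto simp: smult_assoc1)
    then have "a \<otimes> s \<in> P" using a(1) sR by (simp add: P_def)
    then show False using primeideal.I_prime[OF P a(1) sR] a(2) \<open>s \<notin> P\<close> by blast
  qed
  then obtain f where f: "f \<in> X" and fP: "\<And>r. r \<in> carrier R \<Longrightarrow> r \<odot>\<^bsub>M\<^esub> f \<in> N \<Longrightarrow> r \<in> P"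
    by blast
  have fM: "f \<in> carrier M" using f X by blast
  let ?L = "(\<lambda>r. r \<odot>\<^bsub>M\<^esub> f) ` carrier R"
  note L = submodule_cyclic[OF fM]
  have "f \<notin> N"
  proof
    assume "f \<in> N"
    then have "s \<odot>\<^bsub>M\<^esub> f \<in> N" using submodule_smult[OF N sR] by blast
    then show False using fP[OF sR] \<open>s \<notin> P\<close> by blast
  qed
  moreover have "f \<in> ?L" using fM by (intro image_eqI[of _ _ "\<one>"]) auto
  ultimately have "N \<subset> N <+>\<^bsub>M\<^esub> ?L" using set_add_upper[OF N L] by blast
  then obtain t where t: "t \<in> S" "s_finite R t (M\<lparr>carrier := N <+>\<^bsub>M\<^esub> ?L\<rparr>)"
    using N_max[OF submodule_set_add[OF N L]] by (auto simp: S_finite_def)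
  obtain u where u: "u \<in> S" "s_finite R u (M\<lparr>carrier := ideal_times_module P\<rparr>)"
    using primes[OF P] by (auto simp: S_finite_def)
  have "ideal_times_module P \<subseteq> N"
    unfolding ideal_times_module_def by (rule span_least[OF N]) (auto simp: P_def)
  moreover have "N \<inter> ?L \<subseteq> ideal_times_module P"
  proof
    fix x assume "x \<in> N \<inter> ?L"
    then obtain r where r: "r \<in> carrier R" "x = r \<odot>\<^bsub>M\<^esub> f" "x \<in> N" by blast
    then have "r \<in> P" using fP by blast
    with r fM show "x \<in> ideal_times_module P"
      unfolding ideal_times_module_def by (intro subsetD[OF span_superset]) blast
  qed
  ultimately have "s_finite R (u \<otimes> t) (M\<lparr>carrier := N\<rparr>)"
    using t u SR by (intro s_finite_split[OF N L ideal_times_submodule[OF PR]]) auto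
  then show False
    using N_inf submonoid.m_closed[OF S u(1) t(1)] by (auto simp: S_finite_def)
qed

text \<open>The anti-Archimedean condition turns the individual multipliers into a single one. With
  one \<open>s\<close> serving \<open>M\<close> and all \<open>P M\<close>, the preceding theorem applies to the multiplicative set of
  powers of \<open>s\<close>, so every submodule is \<open>s\<^sup>n\<close>-finite for some \<open>n\<close>; an element of \<open>S\<close> divisible
  by all powers of \<open>s\<close> then works for all submodules at once.\<close>

theorem uniformly_S_Noetherian_of_prime_multiples:
  assumes S: "submonoid S R" and anti: "anti_Archimedean R S"
    and s: "s \<in> S" and M_fin: "s_finite R s M"
    and primes: "\<And>P. primeideal P R \<Longrightarrow> s_finite R s (M\<lparr>carrier := ideal_times_module P\<rparr>)"
  shows "uniformly_S_Noetherian_module R S M"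
proof -
  have sR: "s \<in> carrier R" using s submonoid.subset[OF S] by blast
  let ?Q = "range (\<lambda>n::nat. s [^] n)"
  have "s [^] (1::nat) \<in> ?Q" by (rule rangeI)
  then have sQ: "s \<in> ?Q" using sR by simp
  have Q: "submonoid ?Q R"
  proof (rule submonoid.intro)
    show "?Q \<subseteq> carrier R" using sR by auto
    show "x \<otimes> y \<in> ?Q" if "x \<in> ?Q" "y \<in> ?Q" for x y
      using that sR by (auto simp: R.nat_pow_mult)
    show "\<one> \<in> ?Q" by (rule image_eqI[of _ _ 0]) auto
  qed
  obtain u where u: "u \<in> S" "\<And>n::nat. 1 \<le> n \<Longrightarrow> u \<in> PIdl (s [^] n)"
    using anti s unfolding anti_Archimedean_def by fastforce
  have "s_finite R u (M\<lparr>carrier := H\<rparr>)" if H: "submodule H R M" for H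
  proof -
    have "S_finite R ?Q (M\<lparr>carrier := H\<rparr>)"
      using sQ M_fin primes
      by (intro S_finite_of_prime_multiples[OF Q _ _ H]; unfold S_finite_def; blast)
    then obtain n :: nat where n: "s_finite R (s [^] n) (M\<lparr>carrier := H\<rparr>)"
      by (auto simp: S_finite_def)
    \<comment> \<open>only the positive powers are known to divide \<open>u\<close>, so pass from \<open>n\<close> to \<open>n + 1\<close>\<close>
    have "u \<in> PIdl (s [^] Suc n)" by (rule u(2)) simp
    then obtain c where c: "c \<in> carrier R" "u = c \<otimes> s [^] Suc n"
      by (auto simp: cgenideal_def)
    then have "u = (c \<otimes> s) \<otimes> s [^] n"
      using sR by (simp add: R.m_ac)
    then show ?thesis
      using s_finite_multiple[OF H _ _ n, of "c \<otimes> s"] c sR by simp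
  qed
  then show ?thesis
    using u(1) by (auto simp: uniformly_S_Noetherian_module_def)
qed

end

section \<open>Ring extensions\<close>

locale ring_extension = T: cring T for T (structure) and R +
  assumes subring: "subring R T"
begin

abbreviation A where "A \<equiv> T\<lparr>carrier := R\<rparr>"

sublocale MR: module A "regular_module T"
  by (rule regular_module_subring[OF T.cring_axioms subring])

sublocale MT: module T "regular_module T"
  using regular_module_subring[OF T.cring_axioms T.carrier_is_subring] by simp

lemma regular_simps [simp]:
  "carrier (regular_module T) = carrier T" "add (regular_module T) = add T"
  "zero (regular_module T) = zero T" "smult (regular_module T) = mult T"
  by (simp_all add: regular_module_def)

lemma R_subset: "R \<subseteq> carrier T"
  using subringE(1)[OF subring] .

lemma regular_module_subring_eq: "regular_module A = (regular_module T)\<lparr>carrier := R\<rparr>"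
  by (simp add: regular_module_def)

lemma submodule_restrict_scalars:
  "submodule H T (regular_module T) \<Longrightarrow> submodule H A (regular_module T)"
  unfolding MT.submodule_iff MR.submodule_iff using R_subset by auto

lemma span_restrict_scalars:
  "submodule_span A (regular_module T) X \<subseteq> submodule_span T (regular_module T) X"
  unfolding submodule_span_def using submodule_restrict_scalars by blast

lemma ideal_iff_submodule: "ideal I T \<longleftrightarrow> submodule I T (regular_module T)"
proof
  assume "ideal I T"
  then interpret ideal I T .
  show "submodule I T (regular_module T)"
    unfolding MT.submodule_iff using a_subset I_l_closed by auto
next
  assume I: "submodule I T (regular_module T)"
  have "subgroup I (add_monoid T)"
    using submodule.axioms(1)[OF I] by (simp add: subgroup_def a_inv_def m_inv_def)
  moreover have l: "x \<otimes> a \<in> I" if "a \<in> I" "x \<in> carrier T" for a x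
    using MT.submodule_smult[OF I that(2,1)] by simp
  moreover have "a \<otimes> x \<in> I" if "a \<in> I" "x \<in> carrier T" for a x
    using l[OF that] MT.submodule_subset[OF I] that by (simp add: T.m_comm subset_iff)
  ultimately show "ideal I T"
    by (intro idealI T.ring_axioms)
qed

lemma submodule_genideal:
  "X \<subseteq> carrier T \<Longrightarrow> submodule (Idl X) T (regular_module T)"
  using T.genideal_ideal by (simp add: ideal_iff_submodule)

lemma genideal_least_submodule:
  "submodule H T (regular_module T) \<Longrightarrow> X \<subseteq> H \<Longrightarrow> Idl X \<subseteq> H"
  using T.genideal_minimal by (simp add: ideal_iff_submodule)

lemma primeideal_subset: "primeideal \<pp> A \<Longrightarrow> \<pp> \<subseteq> R"
  using additive_subgroup.a_subset[OF ideal.axioms(1)[OF primeideal.axioms(1)]] by fastforce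

text \<open>Only an \<open>R\<close>-submodule \<open>H\<close> is given, so \<open>{z. s z \<in> H}\<close> need not be a \<open>T\<close>-ideal; the
  quantifier over \<open>t\<close> selects the largest \<open>T\<close>-ideal inside it. This is how an inclusion in an
  \<open>R\<close>-span is proved for all of a \<open>T\<close>-span by looking at its generators.\<close>

lemma transporter_submodule:
  assumes "s \<in> carrier T" and H: "submodule H A (regular_module T)"
  shows "submodule {z \<in> carrier T. \<forall>t\<in>carrier T. s \<otimes> (t \<otimes> z) \<in> H} T (regular_module T)"
  (is "submodule ?K _ _")
proof -
  have "a \<otimes> z \<in> ?K" if a: "a \<in> carrier T" and z: "z \<in> ?K" for a z
  proof -
    have "s \<otimes> (t \<otimes> (a \<otimes> z)) \<in> H" if "t \<in> carrier T" for t
    proof -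
      have "s \<otimes> ((t \<otimes> a) \<otimes> z) \<in> H" using a z that by blast
      then show ?thesis using a z that by (simp add: T.m_assoc)
    qed
    with a z show ?thesis by simp
  qed
  then show ?thesis
    using assms MR.submodule_zero[OF H] MR.submodule_add[OF H] unfolding MT.submodule_iff
    by (auto simp: T.r_distr)
qed

lemma ideal_times_eq_genideal:
  assumes p: "\<pp> \<subseteq> R"
  shows "MR.ideal_times_module \<pp> = Idl \<pp>"
proof
  have pT: "\<pp> \<subseteq> carrier T" using p R_subset by blast
  have I: "submodule (Idl \<pp>) T (regular_module T)" using submodule_genideal[OF pT] .
  show "MR.ideal_times_module \<pp> \<subseteq> Idl \<pp>"
    unfolding MR.ideal_times_module_def
  proof (rule MR.span_least[OF submodule_restrict_scalars[OF I]], clarsimp)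
    fix q m assume "q \<in> \<pp>" "m \<in> carrier T"
    then show "q \<otimes> m \<in> Idl \<pp>"
      using T.genideal_self[OF pT] ideal.I_r_closed[OF T.genideal_ideal[OF pT]] by blast
  qed
  let ?H = "MR.ideal_times_module \<pp>"
  have H: "submodule ?H A (regular_module T)"
    using p by (intro MR.ideal_times_submodule) auto
  \<comment> \<open>\<open>?H\<close> is not yet known to be a \<open>T\<close>-ideal, so take the largest one inside it\<close>
  let ?K = "{z \<in> carrier T. \<forall>t\<in>carrier T. \<one> \<otimes> (t \<otimes> z) \<in> ?H}"
  have "\<pp> \<subseteq> ?K"
  proof
    fix q assume q: "q \<in> \<pp>"
    have "q \<otimes> t \<in> ?H" if "t \<in> carrier T" for t
      unfolding MR.ideal_times_module_def
      by (rule subsetD[OF MR.span_superset]) (use q that in auto)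
    then show "q \<in> ?K" using q pT by (auto simp: T.m_comm subset_iff)
  qed
  then have K: "Idl \<pp> \<subseteq> ?K"
    by (intro genideal_least_submodule transporter_submodule H) auto
  show "Idl \<pp> \<subseteq> ?H"
  proof
    fix x assume "x \<in> Idl \<pp>"
    with K have "x \<in> carrier T" "\<one> \<otimes> (\<one> \<otimes> x) \<in> ?H" by blast+
    then show "x \<in> ?H" by simp
  qed
qed

text \<open>Products of \<open>R\<close>-almost-generators of \<open>T\<close> with \<open>T\<close>-almost-generators of \<open>I\<close> are
  \<open>R\<close>-almost-generators of \<open>I\<close>, as for towers of finite extensions.\<close>

lemma s_finite_restrict_scalars:
  assumes I: "submodule I T (regular_module T)" and s: "s \<in> R" and t: "t \<in> R"
    and T_fin: "s_finite A s (regular_module T)"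
    and I_fin: "s_finite T t ((regular_module T)\<lparr>carrier := I\<rparr>)"
  shows "s_finite A (s \<otimes> t) ((regular_module T)\<lparr>carrier := I\<rparr>)"
proof -
  note IA = submodule_restrict_scalars[OF I]
  have IT: "I \<subseteq> carrier T" using MT.submodule_subset[OF I] by simp
  have sT: "s \<in> carrier T" and tT: "t \<in> carrier T" using s t R_subset by auto
  have "s_finite A s ((regular_module T)\<lparr>carrier := carrier (regular_module T)\<rparr>)"
    using T_fin by (simp del: regular_simps)
  then obtain Y where Y: "finite Y" "Y \<subseteq> carrier T"
    and sY: "\<forall>x\<in>carrier T. s \<otimes> x \<in> submodule_span A (regular_module T) Y"
    unfolding MR.s_finite_iff[OF MR.carrier_is_submodule] by auto
  obtain X where X: "finite X" "X \<subseteq> I"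
    and tX: "\<forall>x\<in>I. t \<otimes> x \<in> submodule_span T (regular_module T) X"
    using I_fin unfolding MT.s_finite_iff[OF I] by auto
  define Z where "Z = (\<lambda>(x, y). x \<otimes> y) ` (X \<times> Y)"
  have Z: "finite Z" "Z \<subseteq> I"
    using X Y by (auto simp: Z_def intro!: ideal.I_r_closed[OF I[folded ideal_iff_submodule]])
  let ?G = "submodule_span A (regular_module T) Z"
  have G: "submodule ?G A (regular_module T)"
    using Z IT by (intro MR.span_submodule) auto
  let ?K = "{z \<in> carrier T. \<forall>r\<in>carrier T. s \<otimes> (r \<otimes> z) \<in> ?G}"
  have "X \<subseteq> ?K"
  proof
    fix x assume x: "x \<in> X"
    then have xT: "x \<in> carrier T" using X IT by blast
    have "submodule {y \<in> carrier T. x \<otimes> y \<in> ?G} A (regular_module T)"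
    proof -
      have "x \<otimes> (a \<otimes> y) = a \<otimes> (x \<otimes> y)" if "a \<in> R" "y \<in> carrier T" for a y
        using that xT R_subset by (intro T.m_lcomm) auto
      then show ?thesis
        using MR.submodule_zero[OF G] MR.submodule_add[OF G] MR.submodule_smult[OF G]
          xT R_subset
        unfolding MR.submodule_iff by (auto simp: T.r_distr subset_iff)
    qed
    moreover have "Y \<subseteq> {y \<in> carrier T. x \<otimes> y \<in> ?G}"
      using x Y MR.span_superset[of Z] by (auto simp: Z_def)
    ultimately have sub: "submodule_span A (regular_module T) Y \<subseteq> {y \<in> carrier T. x \<otimes> y \<in> ?G}"
      by (rule MR.span_least)
    have "s \<otimes> (r \<otimes> x) \<in> ?G" if r: "r \<in> carrier T" for r
    proof -
      have "s \<otimes> (r \<otimes> x) = x \<otimes> (s \<otimes> r)" using r xT sT by (simp add: T.m_ac)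
      then show ?thesis using sY r sub by auto
    qed
    then show "x \<in> ?K" using xT by blast
  qed
  then have K: "submodule_span T (regular_module T) X \<subseteq> ?K"
    by (rule MT.span_least[OF transporter_submodule[OF sT G]])
  have "(s \<otimes> t) \<otimes> x \<in> ?G" if x: "x \<in> I" for x
  proof -
    have "s \<otimes> (\<one> \<otimes> (t \<otimes> x)) \<in> ?G" using x tX K by blast
    then show ?thesis using x IT sT tT by (auto simp: T.m_assoc subset_iff)
  qed
  then show ?thesis
    unfolding MR.s_finite_iff[OF IA] using Z by auto
qed

lemma s_finite_extend_scalars:
  assumes p: "\<pp> \<subseteq> carrier T" "submodule \<pp> A (regular_module T)" and s: "s \<in> R"
    and fin: "s_finite A s ((regular_module T)\<lparr>carrier := \<pp>\<rparr>)"
  shows "s_finite T s ((regular_module T)\<lparr>carrier := Idl \<pp>\<rparr>)"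
proof -
  have sT: "s \<in> carrier T" using s R_subset by blast
  obtain X where X: "finite X" "X \<subseteq> \<pp>"
    and sX: "\<forall>x\<in>\<pp>. s \<otimes> x \<in> submodule_span A (regular_module T) X"
    using fin unfolding MR.s_finite_iff[OF p(2)] by auto
  let ?G = "submodule_span T (regular_module T) X"
  have G: "submodule ?G T (regular_module T)"
    using X p by (intro MT.span_submodule) auto
  have "Idl \<pp> \<subseteq> {x \<in> carrier T. s \<otimes> x \<in> ?G}"
    using MT.submodule_smult_vimage[OF sT G] sX span_restrict_scalars p
    by (intro genideal_least_submodule) auto
  then show ?thesis
    unfolding MT.s_finite_iff[OF submodule_genideal[OF p(1)]]
    using X T.genideal_self[OF p(1)] by auto
qed

lemma R_submodule: "submodule R A (regular_module T)"
  unfolding MR.submodule_iff using R_subset subringE[OF subring] by auto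

lemma prime_submodule:
  assumes "primeideal \<pp> A"
  shows "submodule \<pp> A ((regular_module T)\<lparr>carrier := R\<rparr>)"
proof -
  interpret \<pp>: ideal \<pp> A by (rule primeideal.axioms(1)[OF assms])
  have "submodule \<pp> A (regular_module T)"
    unfolding MR.submodule_iff
    using \<pp>.I_l_closed \<pp>.a_closed \<pp>.zero_closed primeideal_subset[OF assms] R_subset by auto
  then show ?thesis
    using primeideal_subset[OF assms] by (simp add: MR.submodule_restrict_iff[OF R_submodule])
qed

lemma uniformly_S_Noetherian_module_imp_subring:
  assumes "uniformly_S_Noetherian_module A S (regular_module T)"
  shows "uniformly_S_Noetherian_ring A S"
  using assms
  unfolding uniformly_S_Noetherian_ring_def uniformly_S_Noetherian_module_def
    regular_module_subring_eq MR.submodule_restrict_iff[OF R_submodule]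
  by auto

lemma uniformly_S_Noetherian_module_imp_extension:
  assumes "uniformly_S_Noetherian_module A S (regular_module T)"
  shows "uniformly_S_Noetherian_ring T S"
proof -
  have "s_finite T s ((regular_module T)\<lparr>carrier := H\<rparr>)"
    if "submodule H T (regular_module T)" "s_finite A s ((regular_module T)\<lparr>carrier := H\<rparr>)"
    for s H
    using that(2) span_restrict_scalars
    unfolding MT.s_finite_iff[OF that(1)]
      MR.s_finite_iff[OF submodule_restrict_scalars[OF that(1)]]
    by blast
  then show ?thesis
    using assms submodule_restrict_scalars
    unfolding uniformly_S_Noetherian_ring_def uniformly_S_Noetherian_module_def by blast
qed

lemma extended_primes_s_finite_of_subring:
  assumes "uniformly_S_Noetherian_ring A S" and "S \<subseteq> R"
  shows "\<exists>s\<in>S. \<forall>\<pp>. primeideal \<pp> A \<longrightarrow> s_finite T s ((regular_module T)\<lparr>carrier := Idl \<pp>\<rparr>)"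
proof -
  obtain s where s: "s \<in> S" and fin: "\<And>H. submodule H A ((regular_module T)\<lparr>carrier := R\<rparr>) \<Longrightarrow>
      s_finite A s ((regular_module T)\<lparr>carrier := H\<rparr>)"
    using assms(1)
    unfolding uniformly_S_Noetherian_ring_def uniformly_S_Noetherian_module_def
      regular_module_subring_eq by auto
  have "s_finite T s ((regular_module T)\<lparr>carrier := Idl \<pp>\<rparr>)" if p: "primeideal \<pp> A" for \<pp>
    using fin[OF prime_submodule[OF p]] prime_submodule[OF p] primeideal_subset[OF p]
      R_subset s assms(2)
    unfolding MR.submodule_restrict_iff[OF R_submodule]
    by (intro s_finite_extend_scalars) auto
  with s show ?thesis by blast
qed

lemma extended_primes_s_finite_of_extension:
  assumes "uniformly_S_Noetherian_ring T S"
  shows "\<exists>s\<in>S. \<forall>\<pp>. primeideal \<pp> A \<longrightarrow> s_finite T s ((regular_module T)\<lparr>carrier := Idl \<pp>\<rparr>)"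
proof -
  have "submodule (Idl \<pp>) T (regular_module T)" if "primeideal \<pp> A" for \<pp>
    using primeideal_subset[OF that] R_subset by (intro submodule_genideal) blast
  with assms show ?thesis
    unfolding uniformly_S_Noetherian_ring_def uniformly_S_Noetherian_module_def by blast
qed

lemma uniformly_S_Noetherian_module_of_extended_primes:
  assumes S: "submonoid S A" and anti: "anti_Archimedean A S"
    and T_fin: "S_finite A S (regular_module T)"
    and primes: "\<exists>s\<in>S. \<forall>\<pp>. primeideal \<pp> A \<longrightarrow>
      s_finite T s ((regular_module T)\<lparr>carrier := Idl \<pp>\<rparr>)"
  shows "uniformly_S_Noetherian_module A S (regular_module T)"
proof -
  have SR: "S \<subseteq> R" using submonoid.subset[OF S] by simp
  obtain s where s: "s \<in> S" "s_finite A s (regular_module T)"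
    using T_fin by (auto simp: S_finite_def)
  obtain t where t: "t \<in> S" and pfin: "\<And>\<pp>. primeideal \<pp> A \<Longrightarrow>
      s_finite T t ((regular_module T)\<lparr>carrier := Idl \<pp>\<rparr>)"
    using primes by blast
  have sR: "s \<in> R" and tR: "t \<in> R" using s t SR by auto
  have st: "s \<otimes> t \<in> S" using submonoid.m_closed[OF S s(1) t] by simp
  have "s_finite A (t \<otimes> s)
      ((regular_module T)\<lparr>carrier := carrier (regular_module T)\<rparr>)"
    using MR.s_finite_multiple[OF MR.carrier_is_submodule, of t s] s(2) sR tR
    by (simp del: regular_simps)
  then have M_fin: "s_finite A (s \<otimes> t) (regular_module T)"
    using T.m_comm[of s t] subsetD[OF R_subset sR] subsetD[OF R_subset tR]
    by (simp del: regular_simps)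
  have "s_finite A (s \<otimes> t) ((regular_module T)\<lparr>carrier := MR.ideal_times_module \<pp>\<rparr>)"
    if p: "primeideal \<pp> A" for \<pp>
  proof -
    have "\<pp> \<subseteq> R" using primeideal_subset[OF p] .
    moreover from this have "submodule (Idl \<pp>) T (regular_module T)"
      using R_subset by (intro submodule_genideal) blast
    ultimately show ?thesis
      using s_finite_restrict_scalars[OF _ sR tR s(2) pfin[OF p]]
      by (simp add: ideal_times_eq_genideal)
  qed
  then show ?thesis
    by (rule MR.uniformly_S_Noetherian_of_prime_multiples[OF S anti st M_fin])
qed

end

theorem theorem2p7:
  fixes T :: "('a, 'm) ring_scheme" and R S :: "'a set"
  assumes "cring T" and "subring R T"
    and "submonoid S (T\<lparr>carrier := R\<rparr>)"
    and "anti_Archimedean (T\<lparr>carrier := R\<rparr>) S"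
    and "S_finite (T\<lparr>carrier := R\<rparr>) S (regular_module T)"
  shows
    "(uniformly_S_Noetherian_ring (T\<lparr>carrier := R\<rparr>) S \<longleftrightarrow>
        uniformly_S_Noetherian_ring T S) \<and>
     (uniformly_S_Noetherian_ring T S \<longleftrightarrow>
        (\<exists>s\<in>S. \<forall>\<pp>. primeideal \<pp> (T\<lparr>carrier := R\<rparr>) \<longrightarrow>
          s_finite T s ((regular_module T)\<lparr>carrier := Idl\<^bsub>T\<^esub> \<pp>\<rparr>))) \<and>
     ((\<exists>s\<in>S. \<forall>\<pp>. primeideal \<pp> (T\<lparr>carrier := R\<rparr>) \<longrightarrow>
          s_finite T s ((regular_module T)\<lparr>carrier := Idl\<^bsub>T\<^esub> \<pp>\<rparr>)) \<longleftrightarrow>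
        uniformly_S_Noetherian_module (T\<lparr>carrier := R\<rparr>) S (regular_module T))"
proof -
  interpret ring_extension T R
    using assms(1,2) by (simp add: ring_extension_def ring_extension_axioms_def)
  have "S \<subseteq> R" using submonoid.subset[OF assms(3)] by simp
  then show ?thesis
    using extended_primes_s_finite_of_subring[of S]
      extended_primes_s_finite_of_extension[of S]
      uniformly_S_Noetherian_module_of_extended_primes[OF assms(3-5)]
      uniformly_S_Noetherian_module_imp_subring[of S]
      uniformly_S_Noetherian_module_imp_extension[of S]
    by blast
qed

end
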